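(* Let $G$ be a graph with an even number $n\geq 2$ of vertices, and let $\overline{G}$ be its complement. If $\mathrm{mp}(G)\cdot\mathrm{mp}(\overline{G})=\lceil\frac{n-1}{2}\rceil\lfloor\frac{n-1}{2}\rfloor$, then $G$ is $\lceil\frac{n-1}{2}\rceil$-regular or $\lfloor\frac{n-1}{2}\rfloor$-regular.
   Context: All graphs are finite, simple and undirected; $\overline{G}$ is the complement of $G$. A perfect matching is a set of edges covering every vertex exactly once; an almost-perfect matching is a set of edges covering every vertex except one exactly once and missing the remaining vertex. The matching preclusion number $\mathrm{mp}(G)$ is the minimum number of edges whose deletion leaves a graph with neither a perfect matching nor an almost-perfect matching ($\mathrm{mp}(G)=0$ if $G$ has neither). *)

theory Defs
  imports Complex_Main
begin

text \<open>
  A graph is given by its vertex set \<open>V\<close> and its edge set \<open>E\<close>; edges are two-element sets of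
  vertices, so deleting one edge removes one element of \<open>E\<close>.
\<close>

definition all_edges :: "'a set \<Rightarrow> 'a set set" where
  "all_edges V = {e. e \<subseteq> V \<and> card e = 2}"

definition simple_graph :: "'a set \<Rightarrow> 'a set set \<Rightarrow> bool" where
  "simple_graph V E \<longleftrightarrow> finite V \<and> E \<subseteq> all_edges V"

definition complement_edges :: "'a set \<Rightarrow> 'a set set \<Rightarrow> 'a set set" where
  "complement_edges V E = all_edges V - E"

definition degree :: "'a set set \<Rightarrow> 'a \<Rightarrow> nat" where
  "degree E v = card {e \<in> E. v \<in> e}"

definition regular :: "'a set \<Rightarrow> 'a set set \<Rightarrow> nat \<Rightarrow> bool" where
  "regular V E k \<longleftrightarrow> (\<forall>v\<in>V. degree E v = k)"

definition perfect_matching :: "'a set \<Rightarrow> 'a set set \<Rightarrow> 'a set set \<Rightarrow> bool" where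
  "perfect_matching V E M \<longleftrightarrow> M \<subseteq> E \<and> (\<forall>v\<in>V. \<exists>!e. e \<in> M \<and> v \<in> e)"

definition almost_perfect_matching :: "'a set \<Rightarrow> 'a set set \<Rightarrow> 'a set set \<Rightarrow> bool" where
  "almost_perfect_matching V E M \<longleftrightarrow>
     M \<subseteq> E \<and>
     (\<exists>w\<in>V. (\<forall>e\<in>M. w \<notin> e) \<and> (\<forall>v\<in>V - {w}. \<exists>!e. e \<in> M \<and> v \<in> e))"

definition matching_precluded :: "'a set \<Rightarrow> 'a set set \<Rightarrow> bool" where
  "matching_precluded V E \<longleftrightarrow>
     (\<nexists>M. perfect_matching V E M) \<and> (\<nexists>M. almost_perfect_matching V E M)"

text \<open>
  If \<open>E\<close> is already precluded, taking \<open>F = {}\<close> gives the value \<open>0\<close>. For at most one vertex no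
  \<open>F\<close> qualifies and the value is unspecified; for at least two vertices \<open>F = E\<close> always
  qualifies (lemma \<open>matching_precluded_empty\<close>), so the minimum exists.
\<close>

definition mp :: "'a set \<Rightarrow> 'a set set \<Rightarrow> nat" where
  "mp V E = (LEAST k. \<exists>F. F \<subseteq> E \<and> card F = k \<and> matching_precluded V (E - F))"

lemma matching_precluded_empty:
  assumes "card V \<ge> 2"
  shows "matching_precluded V {}"
proof -
  have nonempty: "\<exists>v. v \<in> V - {w}" for w
  proof (rule ccontr)
    assume "\<nexists>v. v \<in> V - {w}"
    then have "V \<subseteq> {w}" by blast
    then have "card V \<le> card {w}" by (intro card_mono) auto
    then show False using assms by simp
  qed
  have "\<not> perfect_matching V {} M" for M
    using nonempty[of undefined] by (auto simp: perfect_matching_def)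
  moreover have "\<not> almost_perfect_matching V {} M" for M
  proof
    assume "almost_perfect_matching V {} M"
    then obtain w where M: "M = {}" and w: "\<forall>v\<in>V - {w}. \<exists>!e. e \<in> M \<and> v \<in> e"
      unfolding almost_perfect_matching_def by auto
    obtain v where "v \<in> V - {w}" using nonempty by iprover
    with w have "\<exists>!e. e \<in> M \<and> v \<in> e" by (rule bspec)
    with M show False by auto
  qed
  ultimately show ?thesis
    by (simp add: matching_precluded_def)
qed

end

theory Submission
  imports Defs
begin

text \<open>
  On an even number of vertices an almost-perfect matching cannot exist, so deleting all edges at
  one vertex precludes matchings and \<open>mp\<close> is at most any vertex degree. With \<open>n = 2m\<close> the
  hypothesis thus gives \<open>m(m - 1) \<le> d(v) (2m - 1 - d(u))\<close> for all vertices \<open>u, v\<close>. The case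
  \<open>u = v\<close> forces every degree to be \<open>m\<close> or \<open>m - 1\<close>; if both values occurred, choosing
  \<open>d(v) = m - 1\<close> and \<open>d(u) = m\<close> would give \<open>m \<le> 1\<close>, and graphs on two vertices are regular.
\<close>

text \<open>The edges of \<open>M\<close> partition \<open>W\<close> into pairs. An almost-perfect
  matching missing \<open>w\<close> is the case \<open>W = V - {w}\<close>.\<close>

lemma card_matched_vertices_even:
  assumes "finite W" and M: "M \<subseteq> Pow W" and two: "\<And>e. e \<in> M \<Longrightarrow> card e = 2"
    and cover: "\<And>v. v \<in> W \<Longrightarrow> \<exists>!e. e \<in> M \<and> v \<in> e"
  shows "even (card W)"
proof -
  have "finite M" using M assms(1) by (meson finite_Pow_iff finite_subset)
  have "W = \<Union>M" using M cover by blast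
  moreover have "card (\<Union>M) = (\<Sum>e\<in>M. card e)"
  proof (rule card_Union_disjoint)
    \<comment> \<open>Two distinct edges sharing a vertex would violate the uniqueness in
      \<open>cover\<close> there.\<close>
    show "pairwise disjnt M"
      unfolding pairwise_def disjnt_def using cover M by blast
    show "finite e" if "e \<in> M" for e
      using two[OF that] by (metis card.infinite zero_neq_numeral)
  qed
  ultimately show ?thesis using two by (simp add: dvd_sum)
qed

lemma no_almost_perfect_matching_if_even:
  assumes G: "simple_graph V E" and "even (card V)"
  shows "\<not> almost_perfect_matching V E M"
proof
  assume "almost_perfect_matching V E M"
  then obtain w where ME: "M \<subseteq> E" and w: "w \<in> V" "\<forall>e\<in>M. w \<notin> e"
    and cover: "\<forall>v\<in>V - {w}. \<exists>!e. e \<in> M \<and> v \<in> e"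
    unfolding almost_perfect_matching_def by blast
  have fin: "finite V" using G by (simp add: simple_graph_def)
  have "M \<subseteq> all_edges V" using ME G by (auto simp: simple_graph_def)
  then have "even (card (V - {w}))"
    using fin w cover by (intro card_matched_vertices_even[of _ M]) (auto simp: all_edges_def)
  moreover have "card V = Suc (card (V - {w}))"
    by (rule card.remove[OF fin w(1)])
  ultimately show False using \<open>even (card V)\<close> by simp
qed

lemma mp_le_degree:
  assumes G: "simple_graph V E" and "even (card V)" and "v \<in> V"
  shows "mp V E \<le> degree E v"
proof -
  let ?F = "{e \<in> E. v \<in> e}"
  have "simple_graph V (E - ?F)" using G by (auto simp: simple_graph_def)
  then have "\<not> almost_perfect_matching V (E - ?F) M" for M
    using no_almost_perfect_matching_if_even assms(2) by blast
  \<comment> \<open>The vertex \<open>v\<close> is now isolated, so no edge can cover it.\<close>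
  moreover have "\<not> perfect_matching V (E - ?F) M" for M
    using \<open>v \<in> V\<close> unfolding perfect_matching_def by blast
  ultimately have "matching_precluded V (E - ?F)"
    by (simp add: matching_precluded_def)
  then show ?thesis
    unfolding mp_def degree_def by (intro Least_le exI[of _ ?F]) simp
qed

lemma degree_all_edges:
  assumes "v \<in> V"
  shows "degree (all_edges V) v = card V - 1"
proof -
  have "{e \<in> all_edges V. v \<in> e} = (\<lambda>u. {v, u}) ` (V - {v})"
    using assms by (auto simp: all_edges_def card_2_iff)
  moreover have "inj_on (\<lambda>u. {v, u}) (V - {v})"
    by (auto simp: inj_on_def doubleton_eq_iff)
  ultimately show ?thesis
    using assms by (simp add: degree_def card_image)
qed

lemma finite_all_edges: "finite V \<Longrightarrow> finite (all_edges V)"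
  by (rule finite_subset[of _ "Pow V"]) (auto simp: all_edges_def)

lemma degree_complement_edges:
  assumes G: "simple_graph V E" and "v \<in> V"
  shows "degree E v + degree (complement_edges V E) v = card V - 1"
proof -
  have E: "E \<subseteq> all_edges V" and fin: "finite (all_edges V)"
    using G finite_all_edges by (auto simp: simple_graph_def)
  have "{e \<in> all_edges V. v \<in> e} =
      {e \<in> E. v \<in> e} \<union> {e \<in> complement_edges V E. v \<in> e}"
    using E by (auto simp: complement_edges_def)
  moreover have "card ({e \<in> E. v \<in> e} \<union> {e \<in> complement_edges V E. v \<in> e}) =
      degree E v + degree (complement_edges V E) v"
    unfolding degree_def using E fin
    by (intro card_Un_disjoint) (auto simp: complement_edges_def intro: finite_subset)
  ultimately show ?thesis
    using degree_all_edges[OF \<open>v \<in> V\<close>] by (simp add: degree_def)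
qed

text \<open>The only possible edge is \<open>V\<close> itself, which contains \<open>v\<close>. This
  settles two vertices, where the product bound is the trivial \<open>0 \<le> d * c\<close>.\<close>

lemma degree_le_degree_if_card_2:
  assumes G: "simple_graph V E" and "card V = 2" and "v \<in> V"
  shows "degree E u \<le> degree E v"
proof -
  have fin: "finite V" and E: "E \<subseteq> all_edges V"
    using G by (auto simp: simple_graph_def)
  have "e = V" if "e \<in> E" for e
    using that E card_subset_eq[OF fin, of e] \<open>card V = 2\<close> by (auto simp: all_edges_def)
  then have "{e \<in> E. u \<in> e} \<subseteq> {e \<in> E. v \<in> e}" using \<open>v \<in> V\<close> by auto
  moreover have "finite E" using E fin finite_all_edges finite_subset by blast
  ultimately show ?thesis unfolding degree_def by (intro card_mono) auto
qed

text \<open>With an odd sum fixed, the product of two naturals is largest exactly when they differ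
  by one.\<close>

lemma extremal_degree:
  fixes d c m :: nat
  assumes "d + c = 2 * m - 1" and "m * (m - 1) \<le> d * c" and "m \<ge> 1"
  shows "d = m \<or> d = m - 1"
proof -
  obtain k where m: "m = Suc k" using assms(3) by (cases m) auto
  \<comment> \<open>The offset of \<open>d\<close> from \<open>m - 1\<close>; it may be negative,
    hence the integers. In these terms \<open>d * c = k * (k + 1) - a * (a - 1)\<close>.\<close>
  define a where "a = int d - int k"
  have c: "int c = int k + 1 - a"
    using assms(1) m unfolding a_def by linarith
  have "int (m * (m - 1)) \<le> int (d * c)" using assms(2) by (simp only: of_nat_le_iff)
  then have "(int k + 1) * int k \<le> (int k + a) * (int k + 1 - a)"
    using c by (simp add: m a_def algebra_simps)
  then have "a * (a - 1) \<le> 0" by (simp add: algebra_simps)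
  then have "a = 0 \<or> a = 1" by (smt (verit) mult_le_0_iff)
  then show ?thesis unfolding a_def m by auto
qed

theorem theorem5p8:
  fixes V :: "'a set" and E :: "'a set set" and n :: nat
  assumes "simple_graph V E"
    and "card V = n"
    and "even n"
    and "n \<ge> 2"
    and "mp V E * mp V (complement_edges V E) =
           nat \<lceil>(real n - 1) / 2\<rceil> * nat \<lfloor>(real n - 1) / 2\<rfloor>"
  shows "regular V E (nat \<lceil>(real n - 1) / 2\<rceil>) \<or> regular V E (nat \<lfloor>(real n - 1) / 2\<rfloor>)"
proof -
  let ?C = "complement_edges V E"
  obtain m where n: "n = 2 * m" using \<open>even n\<close> by blast
  have m: "m \<ge> 1" using n \<open>n \<ge> 2\<close> by simp
  \<comment> \<open>Here \<open>(n - 1) / 2 = m - 1/2\<close> lies halfway between the two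
    integers.\<close>
  have "\<lceil>(real n - 1) / 2\<rceil> = int m" "\<lfloor>(real n - 1) / 2\<rfloor> = int m - 1"
    unfolding n by (auto simp: ceiling_eq_iff floor_eq_iff)
  then have ce: "nat \<lceil>(real n - 1) / 2\<rceil> = m" and fl: "nat \<lfloor>(real n - 1) / 2\<rfloor> = m - 1"
    by (simp_all add: nat_diff_distrib)
  have C: "simple_graph V ?C"
    using assms(1) by (auto simp: simple_graph_def complement_edges_def)
  have ev: "even (card V)" using assms(2,3) by simp
  \<comment> \<open>Each factor is bounded by the degree at any vertex, so \<open>u\<close> and
    \<open>v\<close> can be chosen independently.\<close>
  have bound: "m * (m - 1) \<le> degree E v * degree ?C u" if "u \<in> V" "v \<in> V" for u v
    using mult_le_mono[OF mp_le_degree[OF assms(1) ev that(2)] mp_le_degree[OF C ev that(1)]]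
      assms(5) unfolding ce fl by simp
  have sum: "degree E v + degree ?C v = 2 * m - 1" if "v \<in> V" for v
    using degree_complement_edges[OF assms(1) that] assms(2) n by simp
  have deg: "degree E v = m \<or> degree E v = m - 1" if "v \<in> V" for v
    using extremal_degree[OF sum bound m] that by blast
  have False if uv: "u \<in> V" "v \<in> V" "degree E u = m" "degree E v = m - 1" for u v
  proof -
    have "degree ?C u = m - 1" using sum[OF uv(1)] uv(3) by simp
    then have "m * (m - 1) \<le> (m - 1) * (m - 1)" using bound[OF uv(1,2)] uv(4) by simp
    \<comment> \<open>A positive \<open>m - 1\<close> would cancel and leave
      \<open>m \<le> m - 1\<close>.\<close>
    then have "m = 1" using m by auto
    \<comment> \<open>Now \<open>n = 2\<close>, with \<open>u\<close> of degree 1 and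
      \<open>v\<close> of degree 0.\<close>
    then show False
      using degree_le_degree_if_card_2[OF assms(1) _ uv(2), of u] assms(2) n uv by simp
  qed
  then show ?thesis
    unfolding ce fl regular_def using deg by blast
qed

end
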